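(* Let $k>0$ and let $P\in\mathcal P_2(\mathbb R)$. Then the functional $$J(Q):=k^2W_2^2(P,Q)+\operatorname{mmse}(Q),\qquad Q\in\mathcal P_2(\mathbb R),$$ admits at least one minimizer $Q^\star\in\mathcal P_2(\mathbb R)$.
   Context: $\mathcal P_2(\mathbb R)$ is the set of Borel probability measures on $\mathbb R$ with finite second moment. $W_2^2(P,Q)=\inf_{\pi}\int (x-y)^2\,\pi(dx,dy)$ over couplings $\pi$ of $P$ and $Q$. For $Q\in\mathcal P_2(\mathbb R)$, $\operatorname{mmse}(Q)=\mathbb E[\operatorname{Var}(Y\mid Y+N)]$ where $Y\sim Q$ and $N\sim\mathcal N(0,1)$ are independent. *)

theory Defs
  imports "HOL-Probability.Probability"
begin

definition P2 :: "real measure set" where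
  "P2 = {Q. prob_space Q \<and> sets Q = sets borel \<and> integrable Q (\<lambda>x. x\<^sup>2)}"

definition couplings :: "real measure \<Rightarrow> real measure \<Rightarrow> (real \<times> real) measure set" where
  "couplings P Q = {\<pi>. prob_space \<pi> \<and> sets \<pi> = sets borel \<and>
     distr \<pi> borel fst = P \<and> distr \<pi> borel snd = Q}"

(* A real-valued infimum of Bochner integrals. On P2 the set of couplings is nonempty
   and the cost is integrable (lemmas below), so no default value is involved. *)
definition W2_sq :: "real measure \<Rightarrow> real measure \<Rightarrow> real" where
  "W2_sq P Q = (INF \<pi>\<in>couplings P Q. \<integral>z. (fst z - snd z)\<^sup>2 \<partial>\<pi>)"

definition cond_var :: "'a measure \<Rightarrow> 'a measure \<Rightarrow> ('a \<Rightarrow> real) \<Rightarrow> 'a \<Rightarrow> real" where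
  "cond_var M F X = real_cond_exp M F (\<lambda>\<omega>. (X \<omega> - real_cond_exp M F X \<omega>)\<^sup>2)"

(* The joint law of independent Y ~ Q and N ~ N(0,1); Y and N are the coordinate projections. *)
definition channel_law :: "real measure \<Rightarrow> (real \<times> real) measure" where
  "channel_law Q = Q \<Otimes>\<^sub>M std_normal_distribution"

(* The sigma-algebra generated by Y + N. *)
definition output_algebra :: "(real \<times> real) measure" where
  "output_algebra = vimage_algebra UNIV (\<lambda>(y, n). y + n) (borel :: real measure)"

definition mmse :: "real measure \<Rightarrow> real" where
  "mmse Q = (\<integral>\<omega>. cond_var (channel_law Q) output_algebra fst \<omega> \<partial>channel_law Q)"

definition J :: "real \<Rightarrow> real measure \<Rightarrow> real measure \<Rightarrow> real" where
  "J k P Q = k\<^sup>2 * W2_sq P Q + mmse Q"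


lemma P2_D:
  assumes "Q \<in> P2"
  shows "prob_space Q" "sets Q = sets borel" "integrable Q (\<lambda>x. x\<^sup>2)" "space Q = UNIV"
  using assms sets_eq_imp_space_eq[of Q borel] by (auto simp: P2_def)

lemma couplings_nonempty:
  assumes "P \<in> P2" "Q \<in> P2"
  shows "couplings P Q \<noteq> {}"
proof -
  interpret P: prob_space P using P2_D assms by blast
  interpret Q: prob_space Q using P2_D assms by blast
  interpret PQ: pair_prob_space P Q ..
  have s: "sets P = sets borel" "sets Q = sets borel" using P2_D assms by blast+
  have "distr (P \<Otimes>\<^sub>M Q) P fst = P"
    by (simp add: Q.distr_pair_fst)
  moreover have "distr (P \<Otimes>\<^sub>M Q) Q snd = Q"
    by (rule measure_eqI)
      (auto simp: emeasure_distr space_pair_measure Q.emeasure_pair_measure_Times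
        measurable_snd P.emeasure_space_1 vimage_snd Times_Int_Times
        dest: sets.sets_into_space[THEN Int_absorb2] intro!: arg_cong2[where f="(*)"])
  moreover have "distr (P \<Otimes>\<^sub>M Q) P fst = distr (P \<Otimes>\<^sub>M Q) borel fst"
    "distr (P \<Otimes>\<^sub>M Q) Q snd = distr (P \<Otimes>\<^sub>M Q) borel snd"
    using s by (auto intro!: distr_cong)
  moreover have "sets (P \<Otimes>\<^sub>M Q) = sets borel"
    using s sets_pair_measure_cong[of P borel Q borel] by (simp only: borel_prod)
  ultimately have "P \<Otimes>\<^sub>M Q \<in> couplings P Q"
    by (simp add: couplings_def PQ.prob_space_axioms)
  then show ?thesis by blast
qed

lemma coupling_cost_integrable:
  assumes "P \<in> P2" "Q \<in> P2" "\<pi> \<in> couplings P Q"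
  shows "integrable \<pi> (\<lambda>z. (fst z - snd z)\<^sup>2)"
proof -
  have s: "sets \<pi> = sets borel" and d: "distr \<pi> borel fst = P" "distr \<pi> borel snd = Q"
    using assms by (auto simp: couplings_def)
  have m: "fst \<in> borel_measurable \<pi>" "snd \<in> borel_measurable \<pi>"
    using s by (simp_all cong: measurable_cong_sets add: borel_measurable_continuous_onI
      continuous_on_fst continuous_on_snd)
  note [measurable] = m
  have a: "integrable \<pi> (\<lambda>z. (fst z)\<^sup>2)" "integrable \<pi> (\<lambda>z. (snd z)\<^sup>2)"
    using P2_D(3)[OF assms(1)] P2_D(3)[OF assms(2)] d m
    by (auto simp: integrable_distr_eq[symmetric, where N=borel and f="\<lambda>x. x\<^sup>2"])
  show ?thesis
  proof (rule Bochner_Integration.integrable_bound)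
    show "integrable \<pi> (\<lambda>z. 2 * (fst z)\<^sup>2 + 2 * (snd z)\<^sup>2)" using a by auto
    show "AE z in \<pi>. norm ((fst z - snd z)\<^sup>2) \<le> norm (2 * (fst z)\<^sup>2 + 2 * (snd z)\<^sup>2)"
    proof (intro AE_I2)
      fix z :: "real \<times> real"
      have "0 \<le> (fst z + snd z)\<^sup>2" by simp
      then have "(fst z - snd z)\<^sup>2 \<le> 2 * (fst z)\<^sup>2 + 2 * (snd z)\<^sup>2"
        by (simp add: power2_eq_square algebra_simps)
      then show "norm ((fst z - snd z)\<^sup>2) \<le> norm (2 * (fst z)\<^sup>2 + 2 * (snd z)\<^sup>2)"
        by simp
    qed
  qed simp
qed

lemma subalgebra_output_algebra:
  assumes "Q \<in> P2"
  shows "subalgebra (channel_law Q) output_algebra"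
proof -
  have sp: "space (channel_law Q) = UNIV"
    using P2_D(4)[OF assms] by (simp add: channel_law_def space_pair_measure)
  have "sets (channel_law Q) = sets (borel \<Otimes>\<^sub>M borel)"
    unfolding channel_law_def using P2_D(2)[OF assms] by (intro sets_pair_measure_cong) auto
  then have "(\<lambda>(y, n). y + n) \<in> measurable (channel_law Q) (borel :: real measure)"
    by (subst measurable_cong_sets[OF _ refl, of _ "borel \<Otimes>\<^sub>M borel"]) auto
  then show ?thesis
    using sp by (auto simp: subalgebra_def output_algebra_def sets_vimage_algebra2 measurable_def)
qed

(* The library's conditional expectation is only meaningful for integrable arguments; both
   arguments occurring in mmse are. *)
lemma mmse_integrable:
  assumes "Q \<in> P2"
  defines "M \<equiv> channel_law Q" and "F \<equiv> output_algebra"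
  shows "integrable M fst"
    and "integrable M (\<lambda>\<omega>. (fst \<omega> - real_cond_exp M F fst \<omega>)\<^sup>2)"
    and "integrable M (cond_var M F fst)"
proof -
  interpret Q: prob_space Q using P2_D assms by blast
  interpret N: prob_space std_normal_distribution by (rule prob_space_normal_density) simp
  interpret QN: pair_prob_space Q std_normal_distribution ..
  interpret M: prob_space M unfolding M_def channel_law_def by (rule QN.prob_space_axioms)
  interpret S: finite_measure_subalgebra M F
    by standard (simp add: M_def F_def subalgebra_output_algebra assms)
  have s: "sets Q = sets borel" using P2_D assms by blast
  have f: "fst \<in> borel_measurable M"
    unfolding M_def channel_law_def
    using measurable_fst[of Q std_normal_distribution] measurable_cong_sets[OF refl s] by blast
  note [measurable] = f
  have "distr M Q fst = Q"
    unfolding M_def channel_law_def by (rule N.distr_pair_fst)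
  moreover have "distr M Q fst = distr M borel fst"
    using s by (auto intro!: distr_cong)
  ultimately have d: "distr M borel fst = Q" by simp
  have sq: "integrable M (\<lambda>\<omega>. (fst \<omega>)\<^sup>2)"
    using P2_D(3)[OF assms(1)] d f
    by (auto simp: integrable_distr_eq[symmetric, where N=borel and f="\<lambda>x. x\<^sup>2"])
  show i: "integrable M fst"
    using f sq by (rule M.square_integrable_imp_integrable)
  have c: "convex_on UNIV (\<lambda>x::real. x\<^sup>2)"
    using convex_power2 by blast
  have e: "integrable M (\<lambda>\<omega>. (real_cond_exp M F fst \<omega>)\<^sup>2)"
    by (rule S.integrable_convex_cond_exp[OF i, where I = UNIV and q = "\<lambda>x. x\<^sup>2"]) (use sq c in auto)
  show l: "integrable M (\<lambda>\<omega>. (fst \<omega> - real_cond_exp M F fst \<omega>)\<^sup>2)"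
  proof (rule Bochner_Integration.integrable_bound)
    show "integrable M (\<lambda>\<omega>. 2 * (fst \<omega>)\<^sup>2 + 2 * (real_cond_exp M F fst \<omega>)\<^sup>2)"
      using sq e by auto
    have "(a - b)\<^sup>2 \<le> 2 * a\<^sup>2 + 2 * b\<^sup>2" for a b :: real
    proof -
      have "0 \<le> (a + b)\<^sup>2" by simp
      then show ?thesis by (simp add: power2_eq_square algebra_simps)
    qed
    then show "AE \<omega> in M. norm ((fst \<omega> - real_cond_exp M F fst \<omega>)\<^sup>2)
        \<le> norm (2 * (fst \<omega>)\<^sup>2 + 2 * (real_cond_exp M F fst \<omega>)\<^sup>2)"
      by (intro AE_I2) simp
  qed simp
  show "integrable M (cond_var M F fst)"
    unfolding cond_var_def by (rule S.real_cond_exp_int(1)[OF l])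
qed

end

(* A minimizing sequence has bounded W_2-distance to P, hence bounded second moments, so it is
   tight and a subsequence converges weakly; it remains to see that both terms of J are weakly
   lower semicontinuous.

   Transport term. (x - y)^2 is the integral of 2 [y <= s, t < x] + 2 [x <= s, t < y] over s <= t.
   For X with cdf F and Y with cdf G this writes E (X - Y)^2 through the probabilities
   P(Y <= s, t < X) >= (G s - F t)^+ and P(X <= s, t < Y) >= (F s - G t)^+, with equality for the
   quantile coupling. So W_2^2 is an integral of positive parts of differences of cdfs, and Fatou's
   lemma applies because the cdfs converge off a countable set.

   Estimation term. With phi the standard normal density and M_i(z) = E [Y^i phi(z - Y)],
   Bayes' formula gives mmse(Q) = int (M_2 - M_1^2 / M_0) dz. The integrand is nonnegative, and
   each M_i(z) is the integral of a bounded continuous function, so Fatou's lemma applies again. *)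
theory Submission
  imports Defs
begin

section \<open>The transport cost in terms of distribution functions\<close>

lemma triangle_sets:
  "{p :: real \<times> real. a \<le> fst p \<and> fst p \<le> snd p \<and> snd p < b} \<in> sets (borel \<Otimes>\<^sub>M borel)"
proof -
  have "Measurable.pred (borel \<Otimes>\<^sub>M borel) (\<lambda>p :: real \<times> real. a \<le> fst p \<and> fst p \<le> snd p \<and> snd p < b)"
    by measurable
  then show ?thesis by (simp add: pred_def space_pair_measure)
qed

text \<open>The region is a right triangle with both legs of length (b - a)^+, so twice its area is
  the square of that length. The area is computed slice by slice at fixed second coordinate
  t.\<close>

lemma nn_integral_triangle:
  fixes a b :: real
  shows "(\<integral>\<^sup>+p. 2 * indicator {p. a \<le> fst p \<and> fst p \<le> snd p \<and> snd p < b} p \<partial>(lborel :: (real \<times> real) measure))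
    = ennreal ((max 0 (b - a))\<^sup>2)"
proof -
  note [measurable] = triangle_sets[of a b]
  \<comment> \<open>The slice is [a, t], of length t - a, as long as a \<le> t < b. Leaving out the
    null point t = b turns the range of t into a closed interval, on which the fundamental theorem
    of calculus applies; for b < a it shrinks to the point a, where the weight is 0.\<close>
  have inner: "(\<integral>\<^sup>+s. 2 * indicator {p. a \<le> fst p \<and> fst p \<le> snd p \<and> snd p < b} (s, t) \<partial>lborel)
      = ennreal (2 * (t - a)) * indicator {a..max a b} t" if "t \<noteq> b" for t
  proof -
    have "(\<integral>\<^sup>+s. 2 * indicator {p. a \<le> fst p \<and> fst p \<le> snd p \<and> snd p < b} (s, t) \<partial>lborel)
      = (\<integral>\<^sup>+s. (2 * indicator {..<b} t) * indicator {a..t} s \<partial>lborel)"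
      by (intro nn_integral_cong) (auto split: split_indicator)
    also have "\<dots> = 2 * indicator {..<b} t * emeasure lborel {a..t}"
      by (subst nn_integral_cmult_indicator) auto
    also have "\<dots> = ennreal (2 * (t - a)) * indicator {a..max a b} t"
    proof (cases "a \<le> t")
      case True
      then show ?thesis using that
        by (auto split: split_indicator simp: ennreal_mult max_def simp del: ring_distribs right_diff_distrib_numeral)
    qed auto
    finally show ?thesis .
  qed
  have "(\<integral>\<^sup>+p. 2 * indicator {p. a \<le> fst p \<and> fst p \<le> snd p \<and> snd p < b} p \<partial>(lborel :: (real \<times> real) measure))
    = (\<integral>\<^sup>+t. \<integral>\<^sup>+s. 2 * indicator {p. a \<le> fst p \<and> fst p \<le> snd p \<and> snd p < b} (s, t) \<partial>lborel \<partial>lborel)"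
    by (subst lborel_prod[symmetric], subst lborel_pair.nn_integral_snd[symmetric]) auto
  also have "\<dots> = (\<integral>\<^sup>+t. ennreal (2 * (t - a)) * indicator {a..max a b} t \<partial>lborel)"
    using AE_lborel_singleton[of b] inner by (intro nn_integral_cong_AE) auto
  also have "\<dots> = ennreal ((max a b - a)\<^sup>2 - (a - a)\<^sup>2)"
    by (rule nn_integral_FTC_Icc[where F = "\<lambda>t. (t - a)\<^sup>2"]) (auto intro!: derivative_eq_intros)
  also have "(max a b - a)\<^sup>2 - (a - a)\<^sup>2 = (max 0 (b - a))\<^sup>2"
    by (auto simp: max_def)
  finally show ?thesis .
qed

text \<open>The square splits into the squares of the two positive parts, each of which is a
  triangle integral. The factor for s \<le> t is pulled out so that, for random x and y, the
  remaining indicators are those of events.\<close>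

lemma square_eq_triangle:
  fixes x y :: real
  shows "ennreal ((x - y)\<^sup>2) = (\<integral>\<^sup>+p. indicator {p. fst p \<le> snd p} p * 2 *
    (indicator {p. y \<le> fst p \<and> snd p < x} p + indicator {p. x \<le> fst p \<and> snd p < y} p) \<partial>lborel)"
proof -
  have [measurable]: "{p :: real \<times> real. a \<le> fst p \<and> fst p \<le> snd p \<and> snd p < b} \<in> sets lborel" for a b
    using triangle_sets[of a b] unfolding sets_lborel borel_prod .
  have "(x - y)\<^sup>2 = (max 0 (x - y))\<^sup>2 + (max 0 (y - x))\<^sup>2"
    by (auto simp: max_def power2_eq_square algebra_simps)
  then have "ennreal ((x - y)\<^sup>2) = ennreal ((max 0 (x - y))\<^sup>2) + ennreal ((max 0 (y - x))\<^sup>2)"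
    by simp
  also have "\<dots> = (\<integral>\<^sup>+p. 2 * indicator {p. y \<le> fst p \<and> fst p \<le> snd p \<and> snd p < x} p
    + 2 * indicator {p. x \<le> fst p \<and> fst p \<le> snd p \<and> snd p < y} p \<partial>lborel)"
    unfolding nn_integral_triangle[symmetric] by (subst nn_integral_add) auto
  also have "\<dots> = (\<integral>\<^sup>+p. indicator {p. fst p \<le> snd p} p * 2 *
    (indicator {p. y \<le> fst p \<and> snd p < x} p + indicator {p. x \<le> fst p \<and> snd p < y} p) \<partial>lborel)"
    by (intro nn_integral_cong) (auto split: split_indicator)
  finally show ?thesis .
qed

text \<open>Tonelli: integrate \<open>square_eq_triangle\<close> over M and swap, so that the inner
  integrals of indicators become measures of events. The joint law of X and Y then enters the cost
  only through these events.\<close>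

lemma nn_integral_square_diff:
  fixes X Y :: "'a \<Rightarrow> real"
  assumes "sigma_finite_measure M"
    and [measurable]: "X \<in> borel_measurable M" "Y \<in> borel_measurable M"
  shows "(\<integral>\<^sup>+w. ennreal ((X w - Y w)\<^sup>2) \<partial>M) = (\<integral>\<^sup>+p. indicator {p. fst p \<le> snd p} p * 2 *
    (emeasure M {w \<in> space M. Y w \<le> fst p \<and> snd p < X w} +
     emeasure M {w \<in> space M. X w \<le> fst p \<and> snd p < Y w}) \<partial>(lborel :: (real \<times> real) measure))"
proof -
  interpret sigma_finite_measure M by fact
  interpret pair_sigma_finite M "lborel :: (real \<times> real) measure" ..
  have "(\<integral>\<^sup>+w. ennreal ((X w - Y w)\<^sup>2) \<partial>M) =
    (\<integral>\<^sup>+p. \<integral>\<^sup>+w. indicator {p. fst p \<le> snd p} p * 2 *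
    (indicator {p. Y w \<le> fst p \<and> snd p < X w} p + indicator {p. X w \<le> fst p \<and> snd p < Y w} p) \<partial>M \<partial>lborel)"
    unfolding square_eq_triangle
    by (rule Fubini'[symmetric], unfold lborel_prod[symmetric] split_beta, measurable)
  also have "\<dots> = (\<integral>\<^sup>+p. indicator {p. fst p \<le> snd p} p * 2 *
    (emeasure M {w \<in> space M. Y w \<le> fst p \<and> snd p < X w} +
     emeasure M {w \<in> space M. X w \<le> fst p \<and> snd p < Y w}) \<partial>(lborel :: (real \<times> real) measure))"
  proof (intro nn_integral_cong)
    fix p :: "real \<times> real"
    have "(\<integral>\<^sup>+w. indicator {p. fst p \<le> snd p} p * 2 *
      (indicator {p. Y w \<le> fst p \<and> snd p < X w} p + indicator {p. X w \<le> fst p \<and> snd p < Y w} p) \<partial>M)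
      = (\<integral>\<^sup>+w. indicator {p. fst p \<le> snd p} p * 2 *
      (indicator {w \<in> space M. Y w \<le> fst p \<and> snd p < X w} w + indicator {w \<in> space M. X w \<le> fst p \<and> snd p < Y w} w) \<partial>M)"
      by (intro nn_integral_cong) (auto split: split_indicator)
    also have "\<dots> = indicator {p. fst p \<le> snd p} p * 2 *
    (emeasure M {w \<in> space M. Y w \<le> fst p \<and> snd p < X w} +
     emeasure M {w \<in> space M. X w \<le> fst p \<and> snd p < Y w})"
      by (subst nn_integral_cmult, measurable, subst nn_integral_add) auto
    finally show "(\<integral>\<^sup>+w. indicator {p. fst p \<le> snd p} p * 2 *
      (indicator {p. Y w \<le> fst p \<and> snd p < X w} p + indicator {p. X w \<le> fst p \<and> snd p < Y w} p) \<partial>M)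
      = indicator {p. fst p \<le> snd p} p * 2 *
    (emeasure M {w \<in> space M. Y w \<le> fst p \<and> snd p < X w} +
     emeasure M {w \<in> space M. X w \<le> fst p \<and> snd p < Y w})" .
  qed
  finally show ?thesis .
qed

text \<open>Since \<^const>\<open>ennreal\<close> sends negative reals to 0, the differences below are positive parts.\<close>

definition cdf_cost :: "(real \<Rightarrow> real) \<Rightarrow> (real \<Rightarrow> real) \<Rightarrow> ennreal" where
  "cdf_cost F G = (\<integral>\<^sup>+p. indicator {p. fst p \<le> snd p} p * 2 *
    (ennreal (G (fst p) - F (snd p)) + ennreal (F (fst p) - G (snd p))) \<partial>lborel)"

lemma P2_real_distribution: "Q \<in> P2 \<Longrightarrow> real_distribution Q"
  using P2_D(1,2) by (simp add: real_distribution_def real_distribution_axioms_def)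

text \<open>Whenever Y \<le> s, either t < X or X \<le> t, so the union bound applies. If the
  difference of the cdfs is negative, \<open>ennreal\<close> truncates it to 0 and nothing is
  claimed.\<close>

lemma emeasure_le_greater_ge:
  fixes X Y :: "'a \<Rightarrow> real"
  assumes "prob_space M"
    and [measurable]: "X \<in> borel_measurable M" "Y \<in> borel_measurable M"
  shows "ennreal (cdf (distr M borel Y) s - cdf (distr M borel X) t)
    \<le> emeasure M {w \<in> space M. Y w \<le> s \<and> t < X w}"
proof -
  interpret prob_space M by fact
  have "cdf (distr M borel Y) s = prob {w \<in> space M. Y w \<le> s}"
    by (auto simp: cdf_def measure_distr intro!: arg_cong[where f = prob])
  also have "\<dots> \<le> prob ({w \<in> space M. Y w \<le> s \<and> t < X w} \<union> {w \<in> space M. X w \<le> t})"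
    by (intro finite_measure_mono) auto
  also have "\<dots> \<le> prob {w \<in> space M. Y w \<le> s \<and> t < X w} + prob {w \<in> space M. X w \<le> t}"
    by (intro measure_Un_le) auto
  also have "prob {w \<in> space M. X w \<le> t} = cdf (distr M borel X) t"
    by (auto simp: cdf_def measure_distr intro!: arg_cong[where f = prob])
  finally show ?thesis
    by (auto simp: emeasure_eq_measure intro!: ennreal_leI)
qed

text \<open>Bounding each event from below by the marginals alone gives a lower bound shared by all
  couplings of the two laws.\<close>

lemma cdf_cost_le:
  fixes X Y :: "'a \<Rightarrow> real"
  assumes "prob_space M"
    and "X \<in> borel_measurable M" "Y \<in> borel_measurable M"
  shows "cdf_cost (cdf (distr M borel X)) (cdf (distr M borel Y)) \<le> (\<integral>\<^sup>+w. ennreal ((X w - Y w)\<^sup>2) \<partial>M)"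
proof -
  interpret prob_space M by fact
  show ?thesis
    unfolding cdf_cost_def nn_integral_square_diff[OF sigma_finite_measure_axioms assms(2,3)]
    by (intro nn_integral_mono mult_left_mono add_mono emeasure_le_greater_ge assms) auto
qed

section \<open>The quantile coupling and its optimality\<close>

abbreviation quantile :: "real measure \<Rightarrow> real \<Rightarrow> real" where
  "quantile Q u \<equiv> Inf {x. u \<le> cdf Q x}"

text \<open>The endpoints are left out because the set defining the quantile is unbounded below at u
  = 0 and may be empty at u = 1, where \<open>Inf\<close> carries no information.\<close>

abbreviation unit_lborel :: "real measure" where
  "unit_lborel \<equiv> restrict_space lborel {0<..<1}"

lemma prob_space_unit_lborel: "prob_space unit_lborel"
  by (auto simp: space_restrict_space emeasure_restrict_space intro!: prob_spaceI)

lemma quantile_facts: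
  assumes "real_distribution Q"
  shows quantile_measurable: "quantile Q \<in> borel_measurable unit_lborel"
    and distr_quantile: "distr unit_lborel borel (quantile Q) = Q"
    and quantile_le_iff: "u \<in> {0<..<1} \<Longrightarrow> quantile Q u \<le> x \<longleftrightarrow> u \<le> cdf Q x"
proof -
  interpret cdf_distribution Q using assms by (simp add: cdf_distribution_def)
  show "quantile Q \<in> borel_measurable unit_lborel"
    using measurable_CI by (simp cong: measurable_cong_sets add: sets_restrict_space)
  show "distr unit_lborel borel (quantile Q) = Q" by (rule distr_I_eq_M)
  show "u \<in> {0<..<1} \<Longrightarrow> quantile Q u \<le> x \<longleftrightarrow> u \<le> cdf Q x"
    using pseudoinverse[of u x] by auto
qed

text \<open>By \<open>quantile_le_iff\<close> the event says that u lies above F(t) and not above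
  G(s), where F and G are the cdfs of P and Q; its length is the positive part of G(s) - F(t). So
  this one coupling attains the bound of \<open>emeasure_le_greater_ge\<close> for all s and t at
  once.\<close>

lemma emeasure_quantile_le_greater:
  assumes P: "real_distribution P" and Q: "real_distribution Q"
  shows "emeasure unit_lborel {u \<in> space unit_lborel. quantile Q u \<le> s \<and> t < quantile P u}
    = ennreal (cdf Q s - cdf P t)"
proof -
  interpret P: real_distribution P by fact
  interpret Q: real_distribution Q by fact
  have [simp]: "0 \<le> cdf P t" "cdf P t \<le> 1" "0 \<le> cdf Q s" "cdf Q s \<le> 1"
    by (simp_all add: P.cdf_bounded_prob Q.cdf_bounded_prob cdf_def)
  have eq: "{u \<in> space unit_lborel. quantile Q u \<le> s \<and> t < quantile P u} = {cdf P t <.. cdf Q s} \<inter> {0<..<1}"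
    using quantile_le_iff[OF P, of _ t] quantile_le_iff[OF Q, of _ s]
    by (auto simp: space_restrict_space not_le[symmetric])
  have "emeasure unit_lborel ({cdf P t <.. cdf Q s} \<inter> {0<..<1}) = emeasure lborel ({cdf P t <.. cdf Q s} \<inter> {0<..<1})"
    by (subst emeasure_restrict_space) auto
  \<comment> \<open>Both cdf values lie in [0, 1], so intersecting with the open unit interval
    removes at most the point 1.\<close>
  also have "\<dots> = emeasure lborel {cdf P t <.. cdf Q s}"
  proof (intro emeasure_eq_AE)
    show "AE x in lborel. (x \<in> {cdf P t <.. cdf Q s} \<inter> {0<..<1}) = (x \<in> {cdf P t <.. cdf Q s})"
      using AE_lborel_singleton[of 1]
    proof eventually_elim
      case (elim x)
      have "0 < x" if "cdf P t < x" using that \<open>0 \<le> cdf P t\<close> by linarith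
      moreover have "x < 1" if "x \<le> cdf Q s" using that elim \<open>cdf Q s \<le> 1\<close> by linarith
      ultimately show ?case by auto
    qed
  qed auto
  also have "\<dots> = ennreal (cdf Q s - cdf P t)"
    by (cases "cdf P t \<le> cdf Q s") (auto simp: ennreal_neg)
  finally show ?thesis unfolding eq .
qed

lemma nn_integral_quantile:
  assumes P: "real_distribution P" and Q: "real_distribution Q"
  shows "(\<integral>\<^sup>+u. ennreal ((quantile P u - quantile Q u)\<^sup>2) \<partial>unit_lborel) = cdf_cost (cdf P) (cdf Q)"
proof -
  interpret prob_space unit_lborel by (rule prob_space_unit_lborel)
  show ?thesis
    unfolding cdf_cost_def
      nn_integral_square_diff[OF sigma_finite_measure_axioms quantile_measurable[OF P] quantile_measurable[OF Q]]
    by (simp only: emeasure_quantile_le_greater P Q)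
qed

lemma coupling_measurable:
  assumes "sets \<pi> = sets (borel :: (real \<times> real) measure)"
  shows "fst \<in> borel_measurable \<pi>" "snd \<in> borel_measurable \<pi>"
  using assms by (simp_all cong: measurable_cong_sets add: borel_measurable_continuous_onI
    continuous_on_fst continuous_on_snd)

lemma cdf_cost_le_W2_sq:
  assumes "P \<in> P2" "Q \<in> P2"
  shows "cdf_cost (cdf P) (cdf Q) \<le> ennreal (W2_sq P Q)"
proof -
  have le: "cdf_cost (cdf P) (cdf Q) \<le> ennreal (\<integral>z. (fst z - snd z)\<^sup>2 \<partial>\<pi>)"
    if \<pi>: "\<pi> \<in> couplings P Q" for \<pi>
  proof -
    have "prob_space \<pi>" and s: "sets \<pi> = sets borel" and d: "distr \<pi> borel fst = P" "distr \<pi> borel snd = Q"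
      using \<pi> by (auto simp: couplings_def)
    then have "cdf_cost (cdf P) (cdf Q) \<le> (\<integral>\<^sup>+z. ennreal ((fst z - snd z)\<^sup>2) \<partial>\<pi>)"
      using cdf_cost_le[of \<pi> fst snd] coupling_measurable[OF s] by simp
    also have "\<dots> = ennreal (\<integral>z. (fst z - snd z)\<^sup>2 \<partial>\<pi>)"
      by (intro nn_integral_eq_integral coupling_cost_integrable[OF assms \<pi>]) auto
    finally show ?thesis .
  qed
  obtain \<pi> where \<pi>: "\<pi> \<in> couplings P Q" using couplings_nonempty[OF assms] by blast
  \<comment> \<open>\<open>W2_sq\<close> is an infimum of reals, so the extended cost must be known
    to be finite before it is compared with it; a single coupling shows this.\<close>
  have fin: "cdf_cost (cdf P) (cdf Q) = ennreal (enn2real (cdf_cost (cdf P) (cdf Q)))"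
    using le[OF \<pi>] by (intro ennreal_enn2real[symmetric]) (auto intro: le_less_trans)
  have "enn2real (cdf_cost (cdf P) (cdf Q)) \<le> W2_sq P Q"
    unfolding W2_sq_def
  proof (rule cINF_greatest)
    fix \<pi> assume "\<pi> \<in> couplings P Q"
    then show "enn2real (cdf_cost (cdf P) (cdf Q)) \<le> (\<integral>z. (fst z - snd z)\<^sup>2 \<partial>\<pi>)"
      using enn2real_mono[OF le] by fastforce
  qed (rule couplings_nonempty[OF assms])
  then show ?thesis using fin by (metis ennreal_leI)
qed

lemma W2_sq_le:
  assumes "\<pi> \<in> couplings P Q"
  shows "W2_sq P Q \<le> (\<integral>z. (fst z - snd z)\<^sup>2 \<partial>\<pi>)"
  unfolding W2_sq_def by (rule cINF_lower[OF _ assms]) (auto intro!: bdd_belowI[of _ 0])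

lemma W2_sq_nonneg:
  assumes "P \<in> P2" "Q \<in> P2"
  shows "0 \<le> W2_sq P Q"
  unfolding W2_sq_def by (intro cINF_greatest couplings_nonempty assms) auto

lemma square_le_square_diff: "(y::real)\<^sup>2 \<le> 2 * x\<^sup>2 + 2 * (x - y)\<^sup>2"
proof -
  have "0 \<le> (2 * x - y)\<^sup>2" by simp
  then show ?thesis by (simp add: power2_eq_square algebra_simps)
qed

text \<open>The quantile coupling has cost exactly \<open>cdf_cost\<close>. The second moment of Q
  is a conclusion: a law at finite cost from P inherits a finite second moment, which later places
  the weak limit in \<open>P2\<close>.\<close>

lemma W2_sq_le_cdf_cost:
  assumes P: "P \<in> P2" and Q: "real_distribution Q"
    and le: "cdf_cost (cdf P) (cdf Q) \<le> ennreal c" and c: "0 \<le> c"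
  shows "Q \<in> P2" "W2_sq P Q \<le> c"
proof -
  interpret U: prob_space unit_lborel by (rule prob_space_unit_lborel)
  interpret Q: real_distribution Q by fact
  have P': "real_distribution P" using P by (rule P2_real_distribution)
  note [measurable] = quantile_measurable[OF P'] quantile_measurable[OF Q]
  note d = distr_quantile[OF P'] distr_quantile[OF Q]
  have nn: "(\<integral>\<^sup>+u. ennreal ((quantile P u - quantile Q u)\<^sup>2) \<partial>unit_lborel) \<le> ennreal c"
    using le nn_integral_quantile[OF P' Q] by simp
  then have i: "integrable unit_lborel (\<lambda>u. (quantile P u - quantile Q u)\<^sup>2)"
    by (intro integrableI_nonneg) (auto intro: le_less_trans)
  have iP: "integrable unit_lborel (\<lambda>u. (quantile P u)\<^sup>2)"
    using P2_D(3)[OF P] d(1) by (subst (asm) d(1)[symmetric], subst (asm) integrable_distr_eq) auto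
  have "integrable unit_lborel (\<lambda>u. (quantile Q u)\<^sup>2)"
    by (rule Bochner_Integration.integrable_bound[where f = "\<lambda>u. 2 * (quantile P u)\<^sup>2 + 2 * (quantile P u - quantile Q u)\<^sup>2"])
      (use i iP square_le_square_diff in auto)
  then have "integrable Q (\<lambda>x. x\<^sup>2)"
    by (subst d(2)[symmetric], subst integrable_distr_eq) auto
  then show "Q \<in> P2"
    by (simp add: P2_def Q.prob_space_axioms)
  \<comment> \<open>Both quantile functions are driven by the same uniform variable u.\<close>
  let ?\<pi> = "distr unit_lborel borel (\<lambda>u. (quantile P u, quantile Q u))"
  have m [measurable]: "(\<lambda>u. (quantile P u, quantile Q u)) \<in> measurable unit_lborel borel"
    unfolding borel_prod[symmetric] by measurable
  note [measurable] = coupling_measurable[of borel, OF refl]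
  have "?\<pi> \<in> couplings P Q"
    unfolding couplings_def
    by (auto intro!: U.prob_space_distr simp: distr_distr comp_def d)
  then have "W2_sq P Q \<le> (\<integral>z. (fst z - snd z)\<^sup>2 \<partial>?\<pi>)"
    by (rule W2_sq_le)
  also have "\<dots> = (\<integral>u. (quantile P u - quantile Q u)\<^sup>2 \<partial>unit_lborel)"
    by (subst integral_distr) auto
  also have "\<dots> \<le> c"
    using nn c by (subst (asm) nn_integral_eq_integral[OF i]) auto
  finally show "W2_sq P Q \<le> c" .
qed

section \<open>Lower semicontinuity of the transport cost and control of second moments\<close>

lemma AE_lborel_coordinates_not_in_countable:
  assumes "countable N"
  shows "AE p in (lborel :: (real \<times> real) measure). fst p \<notin> N \<and> snd p \<notin> N"
proof -
  have N: "N \<in> sets lborel" "emeasure lborel N = 0"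
    using assms emeasure_lborel_countable by (auto intro: sets.countable)
  have "N \<times> UNIV \<union> UNIV \<times> N \<in> null_sets (lborel \<Otimes>\<^sub>M lborel)"
    using N by (intro null_sets.Un) (auto simp: null_sets_def lborel.emeasure_pair_measure_Times)
  then show ?thesis
    by (intro AE_I'[of "N \<times> UNIV \<union> UNIV \<times> N"]) (auto simp: lborel_prod)
qed

text \<open>Weak convergence gives convergence of the cdfs off the atoms of Q. These are countable,
  so the integrands converge for almost every pair (s, t), and Fatou's lemma applies.\<close>

lemma cdf_cost_lsc:
  assumes \<mu>: "\<And>n. real_distribution (\<mu> n)" and Q: "real_distribution Q"
    and conv: "weak_conv_m \<mu> Q" and F[measurable]: "F \<in> borel_measurable borel"
  shows "cdf_cost F (cdf Q) \<le> liminf (\<lambda>n. cdf_cost F (cdf (\<mu> n)))"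
proof -
  interpret \<mu>: cdf_distribution "\<mu> n" for n using \<mu> by (simp add: cdf_distribution_def)
  interpret Q: cdf_distribution Q using Q by (simp add: cdf_distribution_def)
  let ?N = "{x. 0 < measure Q {x}}"
  let ?f = "\<lambda>G p. indicator {p. fst p \<le> snd p} p * 2 *
    (ennreal (G (fst p) - F (snd p)) + ennreal (F (fst p) - G (snd p)))"
  have tendsto: "(\<lambda>n. cdf (\<mu> n) x) \<longlonglongrightarrow> cdf Q x" if "x \<notin> ?N" for x
    using that conv by (auto simp: weak_conv_m_def weak_conv_def Q.isCont_cdf zero_less_measure_iff)
  have "cdf_cost F (cdf Q) \<le> (\<integral>\<^sup>+p. liminf (\<lambda>n. ?f (cdf (\<mu> n)) p) \<partial>lborel)"
    unfolding cdf_cost_def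
  proof (rule nn_integral_mono_AE)
    show "AE p in lborel. ?f (cdf Q) p \<le> liminf (\<lambda>n. ?f (cdf (\<mu> n)) p)"
      using AE_lborel_coordinates_not_in_countable[OF Q.countable_atoms]
    proof eventually_elim
      case (elim p)
      have "(\<lambda>n. ?f (cdf (\<mu> n)) p) \<longlonglongrightarrow> ?f (cdf Q) p"
        using elim by (intro tendsto_mult_ennreal tendsto_add tendsto_ennrealI tendsto_diff tendsto_const tendsto)
          (auto simp: indicator_def)
      then show ?case
        by (simp add: lim_imp_Liminf)
    qed
  qed
  also have "\<dots> \<le> liminf (\<lambda>n. cdf_cost F (cdf (\<mu> n)))"
    unfolding cdf_cost_def
    by (rule nn_integral_liminf) (unfold lborel_prod[symmetric], measurable)
  finally show ?thesis .
qed

text \<open>\<open>cdf_cost\<close> bounds \<open>W2_sq\<close> from below along the sequence and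
  from above at the limit, which transfers its lower semicontinuity.\<close>

lemma W2_sq_lsc:
  assumes P: "P \<in> P2" and \<mu>: "\<And>n. \<mu> n \<in> P2" and Q: "real_distribution Q"
    and conv: "weak_conv_m \<mu> Q" and w: "(\<lambda>n. W2_sq P (\<mu> n)) \<longlonglongrightarrow> w"
  shows "Q \<in> P2" "W2_sq P Q \<le> w"
proof -
  interpret P: cdf_distribution P using P2_real_distribution[OF P] by (simp add: cdf_distribution_def)
  have "0 \<le> w" using w by (rule LIMSEQ_le_const) (auto intro: W2_sq_nonneg P \<mu>)
  have "cdf_cost (cdf P) (cdf Q) \<le> liminf (\<lambda>n. cdf_cost (cdf P) (cdf (\<mu> n)))"
    by (intro cdf_cost_lsc P2_real_distribution \<mu> Q conv P.measurable_C)
  also have "\<dots> \<le> liminf (\<lambda>n. ennreal (W2_sq P (\<mu> n)))"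
    by (intro Liminf_mono always_eventually allI cdf_cost_le_W2_sq P \<mu>)
  also have "\<dots> = ennreal w"
    using w by (intro lim_imp_Liminf tendsto_ennrealI) auto
  finally show "Q \<in> P2" "W2_sq P Q \<le> w"
    using W2_sq_le_cdf_cost[OF P Q _ \<open>0 \<le> w\<close>] by auto
qed

text \<open>Integrating \<open>square_le_square_diff\<close> against any coupling gives the bound
  with the cost of that coupling; it is first solved for the cost so that the infimum can be
  taken.\<close>

lemma second_moment_le_W2_sq:
  assumes P: "P \<in> P2" and Q: "Q \<in> P2"
  shows "(\<integral>x. x\<^sup>2 \<partial>Q) \<le> 2 * (\<integral>x. x\<^sup>2 \<partial>P) + 2 * W2_sq P Q"
proof -
  have "((\<integral>x. x\<^sup>2 \<partial>Q) - 2 * (\<integral>x. x\<^sup>2 \<partial>P)) / 2 \<le> W2_sq P Q"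
    unfolding W2_sq_def
  proof (rule cINF_greatest)
    fix \<pi> assume \<pi>: "\<pi> \<in> couplings P Q"
    then have s: "sets \<pi> = sets borel" and d: "P = distr \<pi> borel fst" "Q = distr \<pi> borel snd"
      by (auto simp: couplings_def)
    note [measurable] = coupling_measurable[OF s]
    have i: "integrable \<pi> (\<lambda>z. (fst z)\<^sup>2)" "integrable \<pi> (\<lambda>z. (snd z)\<^sup>2)"
      using P2_D(3)[OF P] P2_D(3)[OF Q] unfolding d by (auto simp: integrable_distr_eq)
    note c = coupling_cost_integrable[OF P Q \<pi>]
    have "(\<integral>x. x\<^sup>2 \<partial>Q) = (\<integral>z. (snd z)\<^sup>2 \<partial>\<pi>)"
      unfolding d by (simp add: integral_distr)
    also have "\<dots> \<le> (\<integral>z. 2 * (fst z)\<^sup>2 + 2 * (fst z - snd z)\<^sup>2 \<partial>\<pi>)"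
      using i c by (intro integral_mono square_le_square_diff) auto
    also have "\<dots> = 2 * (\<integral>z. (fst z)\<^sup>2 \<partial>\<pi>) + 2 * (\<integral>z. (fst z - snd z)\<^sup>2 \<partial>\<pi>)"
      using i c by simp
    also have "(\<integral>z. (fst z)\<^sup>2 \<partial>\<pi>) = (\<integral>x. x\<^sup>2 \<partial>P)"
      unfolding d by (simp add: integral_distr)
    finally show "((\<integral>x. x\<^sup>2 \<partial>Q) - 2 * (\<integral>x. x\<^sup>2 \<partial>P)) / 2 \<le> (\<integral>z. (fst z - snd z)\<^sup>2 \<partial>\<pi>)"
      by simp
  qed (rule couplings_nonempty[OF P Q])
  then show ?thesis by simp
qed

section \<open>The minimum mean square error\<close>

text \<open>For Y with law Q and independent standard normal N, order 0 is the density of Y + N at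
  z, and dividing order i by it gives the posterior moment E[Y^i | Y + N = z]. Below, M_i stands for
  the function of order i.\<close>

definition gauss_moment :: "nat \<Rightarrow> real measure \<Rightarrow> real \<Rightarrow> real" where
  "gauss_moment i Q z = (\<integral>y. y ^ i * std_normal_density (z - y) \<partial>Q)"

lemma std_normal_density_le_exp: "std_normal_density t \<le> exp (- (t\<^sup>2 / 2))"
proof -
  have "1 \<le> sqrt (2 * pi)" using pi_ge_two by (simp add: real_le_rsqrt)
  then have "exp (- (t\<^sup>2 / 2)) * (1 / sqrt (2 * pi)) \<le> exp (- (t\<^sup>2 / 2)) * 1"
    by (intro mult_left_mono) auto
  then show ?thesis by (simp add: std_normal_density_def)
qed

lemma square_mult_std_normal_density_le: "t\<^sup>2 * std_normal_density t \<le> 2"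
proof -
  have "t\<^sup>2 / 2 \<le> exp (t\<^sup>2 / 2)" using exp_ge_add_one_self[of "t\<^sup>2 / 2"] by linarith
  then have "t\<^sup>2 * exp (- (t\<^sup>2 / 2)) \<le> 2" by (simp add: exp_minus field_simps)
  moreover have "t\<^sup>2 * std_normal_density t \<le> t\<^sup>2 * exp (- (t\<^sup>2 / 2))"
    by (intro mult_left_mono std_normal_density_le_exp) auto
  ultimately show ?thesis by linarith
qed

text \<open>The Gaussian factor absorbs growth up to order 2: |y^i| is at most 1 + 2 z^2 + 2 (z -
  y)^2, and the density and its product with (z - y)^2 are at most 1 and 2. For fixed z this gives
  both integrability and a bounded test function for weak convergence.\<close>

lemma power_mult_std_normal_density_bounded:
  assumes "i \<le> 2"
  shows "\<bar>y ^ i * std_normal_density (z - y)\<bar> \<le> 2 * z\<^sup>2 + 5"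
proof -
  let ?g = "std_normal_density (z - y)"
  have g: "0 \<le> ?g" "?g \<le> 1"
    using std_normal_density_le_exp[of "z - y"] by (auto intro: order.trans)
  consider "i = 0" | "i = 1" | "i = 2" using assms by linarith
  then have "\<bar>y ^ i\<bar> \<le> 1 + y\<^sup>2"
  proof cases
    case 2
    have "0 \<le> (1 - \<bar>y\<bar>)\<^sup>2" "0 \<le> y\<^sup>2" by simp_all
    then have "2 * \<bar>y\<bar> \<le> 1 + y\<^sup>2" by (simp add: power2_eq_square algebra_simps)
    then show ?thesis using 2 by simp
  qed auto
  also have "\<dots> \<le> 1 + 2 * z\<^sup>2 + 2 * (z - y)\<^sup>2"
  proof -
    have "0 \<le> (2 * z - y)\<^sup>2" by simp
    then show ?thesis by (simp add: power2_eq_square algebra_simps)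
  qed
  finally have "\<bar>y ^ i\<bar> * ?g \<le> (1 + 2 * z\<^sup>2 + 2 * (z - y)\<^sup>2) * ?g"
    by (rule mult_right_mono) (rule g)
  also have "\<dots> = (1 + 2 * z\<^sup>2) * ?g + 2 * ((z - y)\<^sup>2 * ?g)"
    by (simp add: algebra_simps)
  also have "\<dots> \<le> (1 + 2 * z\<^sup>2) * 1 + 2 * 2"
    using g by (intro add_mono mult_left_mono square_mult_std_normal_density_le) auto
  finally show ?thesis using g by (simp add: abs_mult)
qed

context
  fixes Q :: "real measure"
  assumes Q: "real_distribution Q"
begin

interpretation Q: real_distribution Q by (rule Q)

lemma integrable_gauss_moment:
  assumes "i \<le> 2"
  shows "integrable Q (\<lambda>y. y ^ i * std_normal_density (z - y))"
  by (rule Q.integrable_const_bound[of _ "2 * z\<^sup>2 + 5"])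
    (use power_mult_std_normal_density_bounded[OF assms] in auto)

lemma gauss_moment_measurable [measurable]: "gauss_moment i Q \<in> borel_measurable borel"
  unfolding gauss_moment_def by measurable

lemma gauss_moment_0_pos: "0 < gauss_moment 0 Q z"
proof -
  have pos: "0 < std_normal_density t" for t by (simp add: normal_density_pos)
  have i: "integrable Q (\<lambda>y. std_normal_density (z - y))"
    using integrable_gauss_moment[of 0 z] by simp
  have "(\<integral>y. 0 \<partial>Q) < (\<integral>y. std_normal_density (z - y) \<partial>Q)"
    by (rule Q.integral_less_AE_space) (use i pos Q.emeasure_space_1 in auto)
  then show ?thesis by (simp add: gauss_moment_def)
qed

text \<open>Expanding the square gives M_2 - 2 m M_1 + m^2 M_0, which collapses at m = M_1 / M_0.
  The result is M_0(z) times the posterior variance at z.\<close>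

lemma nn_integral_std_normal_square_diff:
  defines "m \<equiv> \<lambda>z. gauss_moment 1 Q z / gauss_moment 0 Q z"
  shows "(\<integral>\<^sup>+y. ennreal (std_normal_density (z - y)) * ennreal ((y - m z)\<^sup>2) \<partial>Q)
    = ennreal (gauss_moment 2 Q z - (gauss_moment 1 Q z)\<^sup>2 / gauss_moment 0 Q z)"
proof -
  note i = integrable_gauss_moment[of 0 z, simplified] integrable_gauss_moment[of 1 z, simplified] integrable_gauss_moment[of 2 z, simplified]
  have eq: "std_normal_density (z - y) * (y - m z)\<^sup>2 = y\<^sup>2 * std_normal_density (z - y)
      - 2 * m z * (y * std_normal_density (z - y)) + (m z)\<^sup>2 * std_normal_density (z - y)" for y
    by (simp add: power2_eq_square algebra_simps)
  have "(\<integral>\<^sup>+y. ennreal (std_normal_density (z - y)) * ennreal ((y - m z)\<^sup>2) \<partial>Q)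
    = (\<integral>\<^sup>+y. ennreal (std_normal_density (z - y) * (y - m z)\<^sup>2) \<partial>Q)"
    by (simp add: ennreal_mult)
  also have "\<dots> = ennreal (\<integral>y. std_normal_density (z - y) * (y - m z)\<^sup>2 \<partial>Q)"
    by (rule nn_integral_eq_integral) (unfold eq, use i in auto, simp add: eq[symmetric])
  also have "(\<integral>y. std_normal_density (z - y) * (y - m z)\<^sup>2 \<partial>Q)
    = gauss_moment 2 Q z - 2 * m z * gauss_moment 1 Q z + (m z)\<^sup>2 * gauss_moment 0 Q z"
    unfolding eq gauss_moment_def using i by simp
  also have "\<dots> = gauss_moment 2 Q z - (gauss_moment 1 Q z)\<^sup>2 / gauss_moment 0 Q z"
    using gauss_moment_0_pos[of z] unfolding m_def by (simp add: power2_eq_square field_simps)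
  finally show ?thesis .
qed

section \<open>Joint law of the input and the output\<close>

lemma sets_channel_law [measurable_cong]: "sets (channel_law Q) = sets (borel \<Otimes>\<^sub>M borel)"
  unfolding channel_law_def by (intro sets_pair_measure_cong) auto

text \<open>Adding y to the noise is a translation for each fixed y, so Lebesgue measure is
  preserved and the noise density is evaluated at z - y.\<close>

lemma channel_law_transform:
  "distr (channel_law Q) (borel \<Otimes>\<^sub>M borel) (\<lambda>w. (fst w, fst w + snd w))
    = density (Q \<Otimes>\<^sub>M lborel) (\<lambda>p. ennreal (std_normal_density (snd p - fst p)))"
proof (rule measure_eqI)
  interpret N: prob_space std_normal_distribution by (rule prob_space_normal_density) simp
  interpret pair_sigma_finite Q lborel ..
  show "sets (distr (channel_law Q) (borel \<Otimes>\<^sub>M borel) (\<lambda>w. (fst w, fst w + snd w)))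
    = sets (density (Q \<Otimes>\<^sub>M lborel) (\<lambda>p. ennreal (std_normal_density (snd p - fst p))))"
    unfolding sets_distr sets_density by (intro sets_pair_measure_cong) auto
  fix X assume "X \<in> sets (distr (channel_law Q) (borel \<Otimes>\<^sub>M borel) (\<lambda>w. (fst w, fst w + snd w)))"
  then have [measurable]: "X \<in> sets (borel \<Otimes>\<^sub>M borel)" by simp
  have [measurable]: "X \<in> sets (Q \<Otimes>\<^sub>M lborel)"
    by (subst sets_pair_measure_cong[of _ borel _ borel]) auto
  have "emeasure (distr (channel_law Q) (borel \<Otimes>\<^sub>M borel) (\<lambda>w. (fst w, fst w + snd w))) X
    = (\<integral>\<^sup>+w. indicator X (fst w, fst w + snd w) \<partial>channel_law Q)"
    by (subst nn_integral_indicator[symmetric], simp, subst nn_integral_distr) auto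
  also have "\<dots> = (\<integral>\<^sup>+y. \<integral>\<^sup>+n. indicator X (y, y + n) \<partial>std_normal_distribution \<partial>Q)"
    unfolding channel_law_def by (subst N.nn_integral_fst[symmetric]) auto
  also have "\<dots> = (\<integral>\<^sup>+y. \<integral>\<^sup>+z. ennreal (std_normal_density (z - y)) * indicator X (y, z) \<partial>lborel \<partial>Q)"
  proof (intro nn_integral_cong)
    fix y
    have "(\<integral>\<^sup>+n. indicator X (y, y + n) \<partial>std_normal_distribution)
      = (\<integral>\<^sup>+n. ennreal (std_normal_density n) * indicator X (y, y + n) \<partial>lborel)"
      by (subst nn_integral_density) auto
    also have "\<dots> = (\<integral>\<^sup>+z. ennreal (std_normal_density (z - y)) * indicator X (y, z) \<partial>lborel)"
      \<comment> \<open>Substitution n = z - y.\<close>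
      by (subst nn_integral_real_affine[where c = 1 and t = "-y"]) auto
    finally show "(\<integral>\<^sup>+n. indicator X (y, y + n) \<partial>std_normal_distribution)
      = (\<integral>\<^sup>+z. ennreal (std_normal_density (z - y)) * indicator X (y, z) \<partial>lborel)" .
  qed
  also have "\<dots> = emeasure (density (Q \<Otimes>\<^sub>M lborel) (\<lambda>p. ennreal (std_normal_density (snd p - fst p)))) X"
    by (subst emeasure_density, measurable, subst lborel.nn_integral_fst[symmetric]) auto
  finally show "emeasure (distr (channel_law Q) (borel \<Otimes>\<^sub>M borel) (\<lambda>w. (fst w, fst w + snd w))) X
    = emeasure (density (Q \<Otimes>\<^sub>M lborel) (\<lambda>p. ennreal (std_normal_density (snd p - fst p)))) X" .
qed

text \<open>The output z is integrated last, so the inner integral is the one that conditions on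
  z.\<close>

lemma nn_integral_channel_law:
  assumes [measurable]: "f \<in> borel_measurable (borel \<Otimes>\<^sub>M borel)"
  shows "(\<integral>\<^sup>+w. f (fst w, fst w + snd w) \<partial>channel_law Q)
    = (\<integral>\<^sup>+z. \<integral>\<^sup>+y. ennreal (std_normal_density (z - y)) * f (y, z) \<partial>Q \<partial>lborel)"
proof -
  interpret pair_sigma_finite Q lborel ..
  have [measurable]: "f \<in> borel_measurable (Q \<Otimes>\<^sub>M lborel)"
    using assms by (subst measurable_cong_sets[OF sets_pair_measure_cong refl, of _ borel _ borel]) auto
  have "(\<integral>\<^sup>+w. f (fst w, fst w + snd w) \<partial>channel_law Q)
    = (\<integral>\<^sup>+p. f p \<partial>distr (channel_law Q) (borel \<Otimes>\<^sub>M borel) (\<lambda>w. (fst w, fst w + snd w)))"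
    by (subst nn_integral_distr) auto
  also have "\<dots> = (\<integral>\<^sup>+p. ennreal (std_normal_density (snd p - fst p)) * f p \<partial>(Q \<Otimes>\<^sub>M lborel))"
    unfolding channel_law_transform by (subst nn_integral_density) auto
  also have "\<dots> = (\<integral>\<^sup>+z. \<integral>\<^sup>+y. ennreal (std_normal_density (z - y)) * f (y, z) \<partial>Q \<partial>lborel)"
    by (subst nn_integral_snd[symmetric]) auto
  finally show ?thesis .
qed

lemma integral_channel_law:
  fixes f :: "real \<times> real \<Rightarrow> real"
  assumes [measurable]: "f \<in> borel_measurable (borel \<Otimes>\<^sub>M borel)"
    and i: "integrable (channel_law Q) (\<lambda>w. f (fst w, fst w + snd w))"
  shows "(\<integral>w. f (fst w, fst w + snd w) \<partial>channel_law Q)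
    = (\<integral>z. (\<integral>y. std_normal_density (z - y) * f (y, z) \<partial>Q) \<partial>lborel)"
proof -
  interpret pair_sigma_finite Q lborel ..
  have [measurable]: "f \<in> borel_measurable (Q \<Otimes>\<^sub>M lborel)"
    using assms by (subst measurable_cong_sets[OF sets_pair_measure_cong refl, of _ borel _ borel]) auto
  have "integrable (distr (channel_law Q) (borel \<Otimes>\<^sub>M borel) (\<lambda>w. (fst w, fst w + snd w))) f"
    using i by (subst integrable_distr_eq) auto
  then have int: "integrable (Q \<Otimes>\<^sub>M lborel) (\<lambda>p. std_normal_density (snd p - fst p) * f p)"
    unfolding channel_law_transform by (subst (asm) integrable_density) auto
  have "(\<integral>w. f (fst w, fst w + snd w) \<partial>channel_law Q)
    = (\<integral>p. f p \<partial>distr (channel_law Q) (borel \<Otimes>\<^sub>M borel) (\<lambda>w. (fst w, fst w + snd w)))"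
    by (subst integral_distr) auto
  also have "\<dots> = (\<integral>p. std_normal_density (snd p - fst p) * f p \<partial>(Q \<Otimes>\<^sub>M lborel))"
    unfolding channel_law_transform by (subst integral_density) auto
  also have "\<dots> = (\<integral>z. (\<integral>y. std_normal_density (z - y) * f (y, z) \<partial>Q) \<partial>lborel)"
    using int integral_snd[of "\<lambda>y z. std_normal_density (z - y) * f (y, z)"] by (simp add: split_beta')
  finally show ?thesis .
qed

end

section \<open>Bayes' formula for the posterior mean and the mmse\<close>

lemma output_algebra_facts:
  shows measurable_output_algebra: "g \<in> borel_measurable borel \<Longrightarrow> (\<lambda>w. g (fst w + snd w)) \<in> borel_measurable output_algebra"
    and output_algebra_cases: "A \<in> sets output_algebra \<Longrightarrow> \<exists>B\<in>sets borel. A = (\<lambda>w. fst w + snd w) -` B"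
proof -
  have eq: "output_algebra = vimage_algebra UNIV (\<lambda>w :: real \<times> real. fst w + snd w) borel"
    by (simp add: output_algebra_def split_beta')
  show "g \<in> borel_measurable borel \<Longrightarrow> (\<lambda>w. g (fst w + snd w)) \<in> borel_measurable output_algebra"
    unfolding eq by (rule measurable_compose[OF measurable_vimage_algebra1]) auto
  show "A \<in> sets output_algebra \<Longrightarrow> \<exists>B\<in>sets borel. A = (\<lambda>w. fst w + snd w) -` B"
    unfolding eq by (auto simp: sets_vimage_algebra2)
qed

definition post_mean :: "real measure \<Rightarrow> real \<Rightarrow> real" where
  "post_mean Q z = gauss_moment 1 Q z / gauss_moment 0 Q z"

text \<open>The density of Y + N at z times the conditional variance of Y given Y + N = z.\<close>

definition mmse_density :: "real measure \<Rightarrow> real \<Rightarrow> real" where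
  "mmse_density Q z = gauss_moment 2 Q z - (gauss_moment 1 Q z)\<^sup>2 / gauss_moment 0 Q z"

text \<open>The conditional expectation is characterized by its integrals over the events that Y + N
  lies in B. There the two inner integrals over y agree for every z, since M_0 times
  \<open>post_mean\<close> is M_1.\<close>

lemma cond_exp_channel_law:
  assumes Q: "Q \<in> P2"
  shows "AE w in channel_law Q. real_cond_exp (channel_law Q) output_algebra fst w = post_mean Q (fst w + snd w)"
proof -
  have Q': "real_distribution Q" using Q by (rule P2_real_distribution)
  interpret Q: real_distribution Q by (rule Q')
  interpret N: prob_space std_normal_distribution by (rule prob_space_normal_density) simp
  interpret QN: pair_prob_space Q std_normal_distribution ..
  interpret M: prob_space "channel_law Q" unfolding channel_law_def by (rule QN.prob_space_axioms)
  interpret S: finite_measure_subalgebra "channel_law Q" output_algebra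
    by standard (simp add: subalgebra_output_algebra Q)
  note [measurable_cong] = sets_channel_law[OF Q']
  note [measurable] = gauss_moment_measurable[OF Q']
  have [measurable]: "post_mean Q \<in> borel_measurable borel"
    unfolding post_mean_def by measurable
  note pos = gauss_moment_0_pos[OF Q']
  have fst: "integrable (channel_law Q) fst" by (rule mmse_integrable(1)[OF Q])
  have i0: "integrable Q (\<lambda>y. std_normal_density (z - y))" for z
    using integrable_gauss_moment[OF Q', of 0 z] by simp
  \<comment> \<open>The characterization requires an integrable candidate. As |M_1(z)| is at most
    the integral of |y| times the kernel, the posterior mean has absolute first moment at most
    E|Y|.\<close>
  have "(\<integral>\<^sup>+w. ennreal (norm (post_mean Q (fst w + snd w))) \<partial>channel_law Q)
    = (\<integral>\<^sup>+z. \<integral>\<^sup>+y. ennreal (std_normal_density (z - y)) * ennreal (norm (post_mean Q z)) \<partial>Q \<partial>lborel)"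
    using nn_integral_channel_law[OF Q', of "\<lambda>p. ennreal (norm (post_mean Q (snd p)))"] by simp
  also have "\<dots> \<le> (\<integral>\<^sup>+z. \<integral>\<^sup>+y. ennreal (std_normal_density (z - y)) * ennreal (norm y) \<partial>Q \<partial>lborel)"
  proof (rule nn_integral_mono)
    fix z
    have "(\<integral>\<^sup>+y. ennreal (std_normal_density (z - y)) * ennreal (norm (post_mean Q z)) \<partial>Q)
      = ennreal (gauss_moment 0 Q z) * ennreal (norm (post_mean Q z))"
      using i0[of z] by (simp add: nn_integral_multc nn_integral_eq_integral gauss_moment_def)
    also have "\<dots> = ennreal (norm (gauss_moment 1 Q z))"
      using pos[of z] by (simp add: post_mean_def ennreal_mult[symmetric] abs_mult)
    also have "\<dots> \<le> (\<integral>\<^sup>+y. norm (y ^ 1 * std_normal_density (z - y)) \<partial>Q)"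
      unfolding gauss_moment_def by (rule integral_norm_bound_ennreal) (simp only: integrable_gauss_moment[OF Q', of 1 z, simplified] power_one_right)
    also have "\<dots> = (\<integral>\<^sup>+y. ennreal (std_normal_density (z - y)) * ennreal (norm y) \<partial>Q)"
      by (intro nn_integral_cong) (simp add: ennreal_mult[symmetric] abs_mult mult.commute)
    finally show "(\<integral>\<^sup>+y. ennreal (std_normal_density (z - y)) * ennreal (norm (post_mean Q z)) \<partial>Q)
      \<le> (\<integral>\<^sup>+y. ennreal (std_normal_density (z - y)) * ennreal (norm y) \<partial>Q)" .
  qed
  also have "\<dots> = (\<integral>\<^sup>+w. ennreal (norm (fst w)) \<partial>channel_law Q)"
    using nn_integral_channel_law[OF Q', of "\<lambda>p. ennreal (norm (fst p))"] by simp
  also have "\<dots> < \<infinity>"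
    using fst by (simp add: integrable_iff_bounded)
  finally have mean: "integrable (channel_law Q) (\<lambda>w. post_mean Q (fst w + snd w))"
    by (intro integrableI_bounded) auto
  show ?thesis
  proof (rule S.real_cond_exp_charact[OF _ fst mean])
    show "(\<lambda>w. post_mean Q (fst w + snd w)) \<in> borel_measurable output_algebra"
      by (rule measurable_output_algebra) measurable
    fix A assume "A \<in> sets output_algebra"
    then obtain B where [measurable]: "B \<in> sets borel" and A: "A = (\<lambda>w. fst w + snd w) -` B"
      using output_algebra_cases by blast
    have ind: "indicator A w = indicator B (fst w + snd w)" for w
      by (simp add: A indicator_def)
    have [measurable]: "(\<lambda>w. fst w + snd w) \<in> borel_measurable (channel_law Q)" by measurable
    have int_B: "integrable (channel_law Q) (\<lambda>w. indicator B (fst w + snd w) * f w)"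
      if "integrable (channel_law Q) f" for f :: "real \<times> real \<Rightarrow> real"
      by (rule Bochner_Integration.integrable_bound[OF that])
        (use that in \<open>auto simp: indicator_def split: if_splits\<close>)
    have "(\<integral>w\<in>A. fst w \<partial>channel_law Q) = (\<integral>w. indicator B (fst w + snd w) * fst w \<partial>channel_law Q)"
      by (simp add: set_lebesgue_integral_def ind)
    also have "\<dots> = (\<integral>z. (\<integral>y. std_normal_density (z - y) * (indicator B z * y) \<partial>Q) \<partial>lborel)"
      using integral_channel_law[OF Q', of "\<lambda>p. indicator B (snd p) * fst p"] int_B[OF fst] by simp
    also have "\<dots> = (\<integral>z. (\<integral>y. std_normal_density (z - y) * (indicator B z * post_mean Q z) \<partial>Q) \<partial>lborel)"
    \<comment> \<open>For fixed z both sides equal the indicator of B at z times M_1(z).\<close>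
    proof (rule Bochner_Integration.integral_cong[OF refl])
      fix z
      have "(\<integral>y. std_normal_density (z - y) * (indicator B z * y) \<partial>Q) = indicator B z * gauss_moment 1 Q z"
        unfolding gauss_moment_def
        by (subst integral_mult_right_zero[symmetric]) (simp add: ac_simps)
      also have "\<dots> = gauss_moment 0 Q z * (indicator B z * post_mean Q z)"
        using pos[of z] by (simp add: post_mean_def)
      also have "\<dots> = (\<integral>y. std_normal_density (z - y) * (indicator B z * post_mean Q z) \<partial>Q)"
        unfolding gauss_moment_def by simp
      finally show "(\<integral>y. std_normal_density (z - y) * (indicator B z * y) \<partial>Q)
        = (\<integral>y. std_normal_density (z - y) * (indicator B z * post_mean Q z) \<partial>Q)" .
    qed
    also have "\<dots> = (\<integral>w. indicator B (fst w + snd w) * post_mean Q (fst w + snd w) \<partial>channel_law Q)"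
      using integral_channel_law[OF Q', of "\<lambda>p. indicator B (snd p) * post_mean Q (snd p)"] int_B[OF mean] by simp
    also have "\<dots> = (\<integral>w\<in>A. post_mean Q (fst w + snd w) \<partial>channel_law Q)"
      by (simp add: set_lebesgue_integral_def ind)
    finally show "(\<integral>w\<in>A. fst w \<partial>channel_law Q) = (\<integral>w\<in>A. post_mean Q (fst w + snd w) \<partial>channel_law Q)" .
  qed
qed

text \<open>Tower property: the conditional variance integrates to the expected squared
  error.\<close>

lemma mmse_eq_integral:
  assumes Q: "Q \<in> P2"
  shows "mmse Q = (\<integral>w. (fst w - real_cond_exp (channel_law Q) output_algebra fst w)\<^sup>2 \<partial>channel_law Q)"
proof -
  have Q': "real_distribution Q" using Q by (rule P2_real_distribution)
  interpret Q: real_distribution Q by (rule Q')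
  interpret N: prob_space std_normal_distribution by (rule prob_space_normal_density) simp
  interpret QN: pair_prob_space Q std_normal_distribution ..
  interpret M: prob_space "channel_law Q" unfolding channel_law_def by (rule QN.prob_space_axioms)
  interpret S: finite_measure_subalgebra "channel_law Q" output_algebra
    by standard (simp add: subalgebra_output_algebra Q)
  show ?thesis
    unfolding mmse_def cond_var_def by (rule S.real_cond_exp_int(2)[OF mmse_integrable(2)[OF Q]])
qed

lemma mmse_nonneg:
  assumes "Q \<in> P2"
  shows "0 \<le> mmse Q"
  unfolding mmse_eq_integral[OF assms] by (rule integral_nonneg_AE) simp

text \<open>Replace the conditional expectation by the posterior mean, integrate over y at fixed z,
  and recognize the weighted posterior variance. The form as a nonnegative integral is the one
  Fatou's lemma needs.\<close>

lemma mmse_eq_nn_integral: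
  assumes Q: "Q \<in> P2"
  shows "ennreal (mmse Q) = (\<integral>\<^sup>+z. ennreal (mmse_density Q z) \<partial>lborel)"
proof -
  have Q': "real_distribution Q" using Q by (rule P2_real_distribution)
  note [measurable] = gauss_moment_measurable[OF Q']
  have [measurable]: "post_mean Q \<in> borel_measurable borel"
    unfolding post_mean_def by measurable
  have "ennreal (mmse Q) = (\<integral>\<^sup>+w. ennreal ((fst w - real_cond_exp (channel_law Q) output_algebra fst w)\<^sup>2) \<partial>channel_law Q)"
    unfolding mmse_eq_integral[OF Q] by (rule nn_integral_eq_integral[OF mmse_integrable(2)[OF Q], symmetric]) simp
  also have "\<dots> = (\<integral>\<^sup>+w. ennreal ((fst w - post_mean Q (fst w + snd w))\<^sup>2) \<partial>channel_law Q)"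
    using cond_exp_channel_law[OF Q] by (intro nn_integral_cong_AE) auto
  also have "\<dots> = (\<integral>\<^sup>+z. \<integral>\<^sup>+y. ennreal (std_normal_density (z - y)) * ennreal ((y - post_mean Q z)\<^sup>2) \<partial>Q \<partial>lborel)"
    using nn_integral_channel_law[OF Q', of "\<lambda>p. ennreal ((fst p - post_mean Q (snd p))\<^sup>2)"] by simp
  also have "\<dots> = (\<integral>\<^sup>+z. ennreal (mmse_density Q z) \<partial>lborel)"
    unfolding post_mean_def mmse_density_def nn_integral_std_normal_square_diff[OF Q'] ..
  finally show ?thesis .
qed

section \<open>Lower semicontinuity of the mmse\<close>

lemma gauss_moment_tendsto:
  assumes \<mu>: "\<And>n. real_distribution (\<mu> n)" and Q: "real_distribution Q"
    and conv: "weak_conv_m \<mu> Q" and i: "i \<le> 2"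
  shows "(\<lambda>n. gauss_moment i (\<mu> n) z) \<longlonglongrightarrow> gauss_moment i Q z"
  unfolding gauss_moment_def
proof (rule weak_conv_imp_integral_bdd_continuous_conv[OF \<mu> Q conv])
  show "isCont (\<lambda>y. y ^ i * std_normal_density (z - y)) y" for y
    unfolding std_normal_density_def by (intro continuous_intros) auto
  show "norm (y ^ i * std_normal_density (z - y)) \<le> 2 * z\<^sup>2 + 5" for y
    using power_mult_std_normal_density_bounded[OF i] by simp
qed

text \<open>The densities converge at every z, because M_0 of the limit law is positive there, and
  Fatou's lemma passes to the integrals.\<close>

lemma mmse_lsc:
  assumes \<mu>: "\<And>n. \<mu> n \<in> P2" and Q: "Q \<in> P2"
    and conv: "weak_conv_m \<mu> Q" and m: "(\<lambda>n. mmse (\<mu> n)) \<longlonglongrightarrow> m"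
  shows "mmse Q \<le> m"
proof -
  note \<mu>' = P2_real_distribution[OF \<mu>] and Q' = P2_real_distribution[OF Q]
  note [measurable] = gauss_moment_measurable[OF \<mu>']
  \<comment> \<open>For negative m, \<open>ennreal m\<close> would be 0 and the final comparison
    would not bound the mmse by m.\<close>
  have "0 \<le> m" using m by (rule LIMSEQ_le_const) (auto intro: mmse_nonneg \<mu>)
  note tendsto = gauss_moment_tendsto[OF \<mu>' Q' conv]
  have "(\<lambda>n. mmse_density (\<mu> n) z) \<longlonglongrightarrow> mmse_density Q z" for z
    unfolding mmse_density_def using gauss_moment_0_pos[OF Q', of z]
    by (intro tendsto_diff tendsto_divide tendsto_power tendsto) auto
  then have "ennreal (mmse_density Q z) = liminf (\<lambda>n. ennreal (mmse_density (\<mu> n) z))" for z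
    by (intro lim_imp_Liminf[symmetric] tendsto_ennrealI) auto
  then have "ennreal (mmse Q) = (\<integral>\<^sup>+z. liminf (\<lambda>n. ennreal (mmse_density (\<mu> n) z)) \<partial>lborel)"
    by (simp add: mmse_eq_nn_integral[OF Q])
  also have "\<dots> \<le> liminf (\<lambda>n. ennreal (mmse (\<mu> n)))"
    unfolding mmse_eq_nn_integral[OF \<mu>]
    by (rule nn_integral_liminf) (unfold mmse_density_def, measurable)
  also have "\<dots> = ennreal m"
    using m by (intro lim_imp_Liminf tendsto_ennrealI) auto
  finally show ?thesis using \<open>0 \<le> m\<close> by simp
qed

section \<open>Existence of a minimizer\<close>

text \<open>Chebyshev: the mass outside (-a, a] is at most C / a^2, uniformly in n.\<close>

lemma tight_of_second_moment_bounded: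
  assumes \<mu>: "\<And>n. \<mu> n \<in> P2" and C: "\<And>n. (\<integral>x. x\<^sup>2 \<partial>\<mu> n) \<le> C"
  shows "tight \<mu>"
  unfolding tight_def
proof (intro conjI allI impI)
  show "real_distribution (\<mu> n)" for n by (rule P2_real_distribution[OF \<mu>])
  fix \<epsilon> :: real assume "0 < \<epsilon>"
  have "0 \<le> C" using C[of 0] by (rule order.trans[rotated]) simp
  \<comment> \<open>With this choice C / a^2 = \<epsilon> C / (C + 1) < \<epsilon>; the summand 1
    keeps a positive when C = 0.\<close>
  define a where "a = sqrt ((C + 1) / \<epsilon>)"
  have a: "0 < a" and a2: "a\<^sup>2 = (C + 1) / \<epsilon>" using \<open>0 \<le> C\<close> \<open>0 < \<epsilon>\<close> by (auto simp: a_def)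
  have "1 - \<epsilon> < measure (\<mu> n) {- a<..a}" for n
  proof -
    interpret real_distribution "\<mu> n" by (rule P2_real_distribution[OF \<mu>])
    have "1 - measure (\<mu> n) {- a<..a} = prob (space (\<mu> n) - {- a<..a})"
      by (subst prob_compl) auto
    also have "\<dots> \<le> prob {x \<in> space (\<mu> n). x\<^sup>2 \<ge> a\<^sup>2}"
      using a by (intro finite_measure_mono) (auto simp: abs_le_square_iff[symmetric])
    also have "\<dots> \<le> (\<integral>x. x\<^sup>2 \<partial>\<mu> n) / a\<^sup>2"
      using a by (intro integral_Markov_inequality_measure[where A = "{}"] P2_D(3)[OF \<mu>]) auto
    also have "\<dots> \<le> C / a\<^sup>2"
      using a by (intro divide_right_mono C) auto
    also have "\<dots> < \<epsilon>"
      using \<open>0 \<le> C\<close> \<open>0 < \<epsilon>\<close> unfolding a2 by (simp add: field_simps)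
    finally show ?thesis by simp
  qed
  moreover have "- a < a" using a by simp
  ultimately show "\<exists>a b. a < b \<and> (\<forall>n. 1 - \<epsilon> < measure (\<mu> n) {a<..b})" by blast
qed

section \<open>Minimizing sequence and passage to the limit\<close>

theorem proposition3p2:
  fixes k :: real and P :: "real measure"
  assumes "k > 0" and "P \<in> P2"
  shows "\<exists>Q_star \<in> P2. \<forall>Q \<in> P2. J k P Q_star \<le> J k P Q"
proof -
  note P = \<open>P \<in> P2\<close>
  define I where "I = (INF Q\<in>P2. J k P Q)"
  have nonneg: "0 \<le> J k P Q" if "Q \<in> P2" for Q
    using that P by (auto simp: J_def intro!: add_nonneg_nonneg mult_nonneg_nonneg W2_sq_nonneg mmse_nonneg)
  have bdd: "bdd_below (J k P ` P2)" using nonneg by (auto intro!: bdd_belowI[of _ 0])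
  have I_le: "I \<le> J k P Q" if "Q \<in> P2" for Q
    unfolding I_def by (rule cINF_lower[OF bdd that])
  have "\<exists>Q\<in>P2. J k P Q < I + 1 / Suc n" for n
    using cINF_less_iff[OF _ bdd, of "I + 1 / Suc n"] P unfolding I_def by auto
  then obtain \<mu> where \<mu>: "\<And>n. \<mu> n \<in> P2" "\<And>n. J k P (\<mu> n) < I + 1 / Suc n" by metis
  have J_lim: "(\<lambda>n. J k P (\<mu> n)) \<longlonglongrightarrow> I"
  proof (rule tendsto_sandwich[OF _ _ tendsto_const])
    show "(\<lambda>n. I + 1 / Suc n) \<longlonglongrightarrow> I"
      using tendsto_add[OF tendsto_const[of I] LIMSEQ_inverse_real_of_nat] by (simp add: inverse_eq_divide)
  qed (use I_le[OF \<mu>(1)] \<mu>(2) in \<open>auto intro!: always_eventually intro: less_imp_le simp del: of_nat_Suc\<close>)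
  \<comment> \<open>Since the mmse is nonnegative, k^2 times the transport cost is at most J, which
    is at most I + 1 along the sequence.\<close>
  define B where "B = (I + 1) / k\<^sup>2"
  have W_le: "W2_sq P (\<mu> n) \<le> B" for n
  proof -
    have "k\<^sup>2 * W2_sq P (\<mu> n) \<le> J k P (\<mu> n)" using mmse_nonneg[OF \<mu>(1)] by (simp add: J_def)
    also have "\<dots> \<le> I + 1" using \<mu>(2)[of n] by (rule less_imp_le[THEN order.trans]) simp
    finally show ?thesis using \<open>k > 0\<close> by (simp add: B_def field_simps)
  qed
  \<comment> \<open>Making the transport costs converge first forces the mmse terms to converge as well.\<close>
  have "\<forall>n. W2_sq P (\<mu> n) \<in> {0..B}" using W_le W2_sq_nonneg[OF P \<mu>(1)] by auto
  then obtain w s where s: "strict_mono s" and w: "((\<lambda>n. W2_sq P (\<mu> n)) \<circ> s) \<longlonglongrightarrow> w"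
    using compact_imp_seq_compact[OF compact_Icc] unfolding seq_compact_def by metis
  have "tight \<mu>"
  proof (rule tight_of_second_moment_bounded[OF \<mu>(1)])
    show "(\<integral>x. x\<^sup>2 \<partial>\<mu> n) \<le> 2 * (\<integral>x. x\<^sup>2 \<partial>P) + 2 * B" for n
      using second_moment_le_W2_sq[OF P \<mu>(1), of n] W_le[of n] by linarith
  qed
  then obtain r Q where r: "strict_mono r" and Q: "real_distribution Q" and conv: "weak_conv_m (\<mu> \<circ> s \<circ> r) Q"
    using tight_imp_convergent_subsubsequence[OF _ s] by blast
  define \<nu> where "\<nu> = \<mu> \<circ> s \<circ> r"
  have \<nu>: "\<nu> n \<in> P2" for n by (simp add: \<nu>_def \<mu>)
  have W_lim: "(\<lambda>n. W2_sq P (\<nu> n)) \<longlonglongrightarrow> w"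
    using LIMSEQ_subseq_LIMSEQ[OF w r] by (simp add: \<nu>_def comp_def)
  have "(\<lambda>n. J k P (\<nu> n)) \<longlonglongrightarrow> I"
    using LIMSEQ_subseq_LIMSEQ[OF J_lim strict_mono_o[OF s r]] by (simp add: \<nu>_def comp_def)
  from tendsto_diff[OF this tendsto_mult[OF tendsto_const[of "k\<^sup>2"] W_lim]]
  have mmse_lim: "(\<lambda>n. mmse (\<nu> n)) \<longlonglongrightarrow> I - k\<^sup>2 * w"
    by (simp add: J_def)
  note conv = conv[folded \<nu>_def]
  have "Q \<in> P2" "W2_sq P Q \<le> w" by (rule W2_sq_lsc[OF P \<nu> Q conv W_lim])+
  moreover from this have "mmse Q \<le> I - k\<^sup>2 * w" by (intro mmse_lsc[OF \<nu> _ conv mmse_lim])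
  \<comment> \<open>Adding the two lower semicontinuity bounds cancels k^2 w and leaves the infimum
    I.\<close>
  ultimately have "J k P Q \<le> k\<^sup>2 * w + (I - k\<^sup>2 * w)"
    unfolding J_def by (intro add_mono mult_left_mono) auto
  then show ?thesis using I_le \<open>Q \<in> P2\<close> by (intro bexI[of _ Q]) force+
qed

end
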